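(* Let $\mathbb{X}$ be an extensive restriction category. Then the relation $\perp_d$ (being decision disjoint) is an interference relation, making $\mathbb{X}$ into a $\perp_d$-restriction category, and this $\perp_d$-restriction category has all binary $\perp_d$-joins.
   Context: Composition is diagrammatic: $fg$ means first $f$, then $g$. A restriction category is a category with an operator sending each $f:A\to B$ to $\overline{f}:A\to A$ such that $\overline{f}f=f$; $\overline{f}\,\overline{g}=\overline{g}\,\overline{f}$ and $\overline{\overline{g}f}=\overline{g}\,\overline{f}$ for $f:A\to B$, $g:A\to C$; and $f\overline{g}=\overline{fg}f$ for $f:A\to B$, $g:B\to C$. For parallel $f,g$: $f\le g$ iff $\overline{f}g=f$. A map $f:A\to B$ is total if $\overline{f}=1_A$. Restriction zeroes: maps $0:A\to B$ with $f0=0=0f$ and $\overline{0}=0$. A coCartesian restriction category is a restriction category with finite coproducts whose injections $\iota_j$ are total. With restriction zeroes, the quasi-projection $\iota_j^\circ:A_1+\dots+A_n\to A_j$ is the unique map with $\iota_j\iota_j^\circ=1_{A_j}$ and $\iota_i\iota_j^\circ=0$ for $i\ne j$. $\nabla:A+\dots+A\to A$ is the codiagonal. An extensive restriction category is a coCartesian restriction category with restriction zeroes such that for every $f:A\to B_1+\dots+B_n$ there is a (necessarily unique) map $\langle f\rangle:A\to A+\dots+A$ ($n$ copies), the decision of $f$, with $\overline{f}=\langle f\rangle\nabla$ and $\langle f\rangle(f+\dots+f)=f(\iota_1+\dots+\iota_n)$. A map $d:A\to A+\dots+A$ is a decision if $\langle d\rangle=d$. Decision disjointness: for $f:A\to B$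 and $g:A\to C$, $f\perp_d g$ iff there is a decision $\langle f\vert g\rangle:A\to A+A$ with $\langle f\vert g\rangle\iota_1^\circ=\overline{f}$ and $\langle f\vert g\rangle\iota_2^\circ=\overline{g}$. An interference relation $\perp$ on a restriction category with restriction zeroes is a family of relations between maps with the same domain ($f:A\to B$, $g:A\to C$) such that: $1_A\perp 0$; $f\perp g\Rightarrow g\perp f$; $f\perp f\Rightarrow f=0$; $f'\perp g'$, $f\le f'$, $g\le g'$ imply $f\perp g$; $f\perp g\Rightarrow hfk\perp hgk'$ for all composable $h,k,k'$; $f\perp g\Rightarrow\overline{f}\perp\overline{g}$. A $\perp$-restriction category is a restriction category with restriction zeroes and a chosen interference relation $\perp$. It has all binary $\perp$-joins if any parallel $f\perp g:A\to B$ have a least upper bound $f\sqcup g$ with respect to $\le$ and $h(f\sqcup g)=hf\sqcup hg$ for all $h:A'\to A$. *)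

theory Defs
  imports Main
begin

record ('o, 'm) cat =
  Obj :: "'o set"
  Arr :: "'m set"
  Dom :: "'m \<Rightarrow> 'o"
  Cod :: "'m \<Rightarrow> 'o"
  Ident :: "'o \<Rightarrow> 'm"
  Comp :: "'m \<Rightarrow> 'm \<Rightarrow> 'm"  (infixl "\<cdot>\<index>" 70)

text \<open>Composition is diagrammatic: \<open>f \<cdot> g\<close> is first \<open>f\<close>, then \<open>g\<close>.\<close>

definition hom :: "('o, 'm, 'x) cat_scheme \<Rightarrow> 'o \<Rightarrow> 'o \<Rightarrow> 'm set" where
  "hom X A B = {f \<in> Arr X. Dom X f = A \<and> Cod X f = B}"

locale category =
  fixes X :: "('o, 'm, 'x) cat_scheme" (structure)
  assumes Dom_Obj: "f \<in> Arr X \<Longrightarrow> Dom X f \<in> Obj X"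
    and Cod_Obj: "f \<in> Arr X \<Longrightarrow> Cod X f \<in> Obj X"
    and Ident_hom: "A \<in> Obj X \<Longrightarrow> Ident X A \<in> hom X A A"
    and Comp_hom: "\<lbrakk>f \<in> hom X A B; g \<in> hom X B C\<rbrakk> \<Longrightarrow> f \<cdot> g \<in> hom X A C"
    and Ident_Comp: "f \<in> hom X A B \<Longrightarrow> Ident X A \<cdot> f = f"
    and Comp_Ident: "f \<in> hom X A B \<Longrightarrow> f \<cdot> Ident X B = f"
    and Comp_assoc:
      "\<lbrakk>f \<in> hom X A B; g \<in> hom X B C; h \<in> hom X C D\<rbrakk> \<Longrightarrow> (f \<cdot> g) \<cdot> h = f \<cdot> (g \<cdot> h)"


record ('o, 'm) rcat = "('o, 'm) cat" +
  Rst :: "'m \<Rightarrow> 'm"  ("\<rho>\<index>")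

locale restriction_category = category X
  for X :: "('o, 'm, 'x) rcat_scheme" (structure) +
  assumes Rst_hom: "f \<in> hom X A B \<Longrightarrow> \<rho> f \<in> hom X A A"
    and Rst_Comp: "f \<in> hom X A B \<Longrightarrow> \<rho> f \<cdot> f = f"
    and Rst_commute: "\<lbrakk>f \<in> hom X A B; g \<in> hom X A C\<rbrakk> \<Longrightarrow> \<rho> f \<cdot> \<rho> g = \<rho> g \<cdot> \<rho> f"
    and Rst_Rst_Comp: "\<lbrakk>f \<in> hom X A B; g \<in> hom X A C\<rbrakk> \<Longrightarrow> \<rho> (\<rho> g \<cdot> f) = \<rho> g \<cdot> \<rho> f"
    and Comp_Rst: "\<lbrakk>f \<in> hom X A B; g \<in> hom X B C\<rbrakk> \<Longrightarrow> f \<cdot> \<rho> g = \<rho> (f \<cdot> g) \<cdot> f"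

definition rle :: "('o, 'm, 'x) rcat_scheme \<Rightarrow> 'm \<Rightarrow> 'm \<Rightarrow> bool"  (infix "\<sqsubseteq>\<index>" 50) where
  "f \<sqsubseteq>\<^bsub>X\<^esub> g \<longleftrightarrow> f \<in> Arr X \<and> g \<in> Arr X \<and> Dom X f = Dom X g \<and> Cod X f = Cod X g
     \<and> \<rho>\<^bsub>X\<^esub> f \<cdot>\<^bsub>X\<^esub> g = f"

definition total :: "('o, 'm, 'x) rcat_scheme \<Rightarrow> 'm \<Rightarrow> bool" where
  "total X f \<longleftrightarrow> f \<in> Arr X \<and> \<rho>\<^bsub>X\<^esub> f = Ident X (Dom X f)"


record ('o, 'm) zcat = "('o, 'm) rcat" +
  Zero :: "'o \<Rightarrow> 'o \<Rightarrow> 'm"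

locale restriction_category_with_zeroes = restriction_category X
  for X :: "('o, 'm, 'x) zcat_scheme" (structure) +
  assumes Zero_hom: "\<lbrakk>A \<in> Obj X; B \<in> Obj X\<rbrakk> \<Longrightarrow> Zero X A B \<in> hom X A B"
    and Comp_Zero: "\<lbrakk>f \<in> hom X A B; C \<in> Obj X\<rbrakk> \<Longrightarrow> f \<cdot> Zero X B C = Zero X A C"
    and Zero_Comp: "\<lbrakk>C \<in> Obj X; f \<in> hom X A B\<rbrakk> \<Longrightarrow> Zero X C A \<cdot> f = Zero X C B"
    and Rst_Zero: "\<lbrakk>A \<in> Obj X; B \<in> Obj X\<rbrakk> \<Longrightarrow> \<rho> (Zero X A B) = Zero X A A"


text \<open>
  Finite coproducts are given by a choice of a coproduct \<open>Copr X As\<close> for every finite list \<open>As\<close>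
  of objects (the empty list giving an initial object). The injections \<open>Inj X As i\<close> are
  indexed from \<open>0\<close>, for \<open>i < length As\<close>.
\<close>

record ('o, 'm) ccat = "('o, 'm) zcat" +
  Copr :: "'o list \<Rightarrow> 'o"
  Inj :: "'o list \<Rightarrow> nat \<Rightarrow> 'm"

text \<open>The field \<open>Zero\<close> is unconstrained in the following locale.\<close>

locale cocartesian_restriction_category = restriction_category X
  for X :: "('o, 'm, 'x) ccat_scheme" (structure) +
  assumes Copr_Obj: "set As \<subseteq> Obj X \<Longrightarrow> Copr X As \<in> Obj X"
    and Inj_hom: "\<lbrakk>set As \<subseteq> Obj X; i < length As\<rbrakk> \<Longrightarrow> Inj X As i \<in> hom X (As ! i) (Copr X As)"
    and Copr_universal:
      "\<lbrakk>set As \<subseteq> Obj X; C \<in> Obj X; \<And>i. i < length As \<Longrightarrow> fs i \<in> hom X (As ! i) C\<rbrakk>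
       \<Longrightarrow> \<exists>!h. h \<in> hom X (Copr X As) C \<and> (\<forall>i < length As. Inj X As i \<cdot> h = fs i)"
    and Inj_total: "\<lbrakk>set As \<subseteq> Obj X; i < length As\<rbrakk> \<Longrightarrow> total X (Inj X As i)"

definition cotuple ::
  "('o, 'm, 'x) ccat_scheme \<Rightarrow> 'o list \<Rightarrow> 'o \<Rightarrow> (nat \<Rightarrow> 'm) \<Rightarrow> 'm" where
  "cotuple X As C fs =
     (THE h. h \<in> hom X (Copr X As) C \<and> (\<forall>i < length As. Inj X As i \<cdot>\<^bsub>X\<^esub> h = fs i))"

text \<open>\<open>f\<^sub>1 + \<dots> + f\<^sub>n : A\<^sub>1 + \<dots> + A\<^sub>n \<rightarrow> B\<^sub>1 + \<dots> + B\<^sub>n\<close>\<close>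

definition copr_map ::
  "('o, 'm, 'x) ccat_scheme \<Rightarrow> 'o list \<Rightarrow> 'o list \<Rightarrow> (nat \<Rightarrow> 'm) \<Rightarrow> 'm" where
  "copr_map X As Bs fs = cotuple X As (Copr X Bs) (\<lambda>i. fs i \<cdot>\<^bsub>X\<^esub> Inj X Bs i)"

definition codiag :: "('o, 'm, 'x) ccat_scheme \<Rightarrow> nat \<Rightarrow> 'o \<Rightarrow> 'm" where
  "codiag X n A = cotuple X (replicate n A) A (\<lambda>i. Ident X A)"

definition quasi_proj :: "('o, 'm, 'x) ccat_scheme \<Rightarrow> 'o list \<Rightarrow> nat \<Rightarrow> 'm" where
  "quasi_proj X As j =
     cotuple X As (As ! j) (\<lambda>i. if i = j then Ident X (As ! j) else Zero X (As ! i) (As ! j))"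


text \<open>
  \<open>decides X Bs f d\<close>: for \<open>f : A \<rightarrow> B\<^sub>1 + \<dots> + B\<^sub>n\<close>, the map \<open>d : A \<rightarrow> A + \<dots> + A\<close> satisfies the two
  equations required of the decision of \<open>f\<close>. The list \<open>Bs\<close> is an argument because the same object
  may arise as the coproduct of several lists.
\<close>

definition decides :: "('o, 'm, 'x) ccat_scheme \<Rightarrow> 'o list \<Rightarrow> 'm \<Rightarrow> 'm \<Rightarrow> bool" where
  "decides X Bs f d \<longleftrightarrow>
     (let n = length Bs; A = Dom X f; As = replicate n A; Cs = replicate n (Copr X Bs) in
        d \<in> hom X A (Copr X As)
        \<and> \<rho>\<^bsub>X\<^esub> f = d \<cdot>\<^bsub>X\<^esub> codiag X n A
        \<and> d \<cdot>\<^bsub>X\<^esub> copr_map X As Cs (\<lambda>i. f) = f \<cdot>\<^bsub>X\<^esub> copr_map X Bs Cs (Inj X Bs))"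

locale extensive_restriction_category =
  cocartesian_restriction_category X + restriction_category_with_zeroes X
  for X :: "('o, 'm, 'x) ccat_scheme" (structure) +
  assumes decision_exists:
    "\<lbrakk>set Bs \<subseteq> Obj X; f \<in> hom X A (Copr X Bs)\<rbrakk> \<Longrightarrow> \<exists>d. decides X Bs f d"

text \<open>
  In an extensive restriction category the decision of a map is unique as a consequence of the
  axioms, so that the description below is well-defined there.
\<close>

definition decision_of :: "('o, 'm, 'x) ccat_scheme \<Rightarrow> 'o list \<Rightarrow> 'm \<Rightarrow> 'm" where
  "decision_of X Bs f = (THE d. decides X Bs f d)"

definition is_decision :: "('o, 'm, 'x) ccat_scheme \<Rightarrow> nat \<Rightarrow> 'o \<Rightarrow> 'm \<Rightarrow> bool" where
  "is_decision X n A d \<longleftrightarrow>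
     d \<in> hom X A (Copr X (replicate n A)) \<and> decision_of X (replicate n A) d = d"

definition decision_disjoint :: "('o, 'm, 'x) ccat_scheme \<Rightarrow> 'm \<Rightarrow> 'm \<Rightarrow> bool" where
  "decision_disjoint X f g \<longleftrightarrow>
     f \<in> Arr X \<and> g \<in> Arr X \<and> Dom X f = Dom X g \<and>
     (\<exists>d. is_decision X 2 (Dom X f) d
        \<and> d \<cdot>\<^bsub>X\<^esub> quasi_proj X (replicate 2 (Dom X f)) 0 = \<rho>\<^bsub>X\<^esub> f
        \<and> d \<cdot>\<^bsub>X\<^esub> quasi_proj X (replicate 2 (Dom X f)) 1 = \<rho>\<^bsub>X\<^esub> g)"


locale interference_relation =
  fixes X :: "('o, 'm, 'x) zcat_scheme" (structure)
    and perp :: "'m \<Rightarrow> 'm \<Rightarrow> bool"  (infix "\<bottom>" 50)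
  assumes perp_same_Dom: "f \<bottom> g \<Longrightarrow> f \<in> Arr X \<and> g \<in> Arr X \<and> Dom X f = Dom X g"
    and perp_Ident_Zero: "\<lbrakk>A \<in> Obj X; B \<in> Obj X\<rbrakk> \<Longrightarrow> Ident X A \<bottom> Zero X A B"
    and perp_sym: "f \<bottom> g \<Longrightarrow> g \<bottom> f"
    and perp_self: "f \<bottom> f \<Longrightarrow> f = Zero X (Dom X f) (Cod X f)"
    and perp_down: "\<lbrakk>f' \<bottom> g'; f \<sqsubseteq> f'; g \<sqsubseteq> g'\<rbrakk> \<Longrightarrow> f \<bottom> g"
    and perp_Comp:
      "\<lbrakk>f \<bottom> g; f \<in> hom X A B; g \<in> hom X A C; h \<in> hom X A' A; k \<in> hom X B B'; k' \<in> hom X C C'\<rbrakk>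
       \<Longrightarrow> h \<cdot> f \<cdot> k \<bottom> h \<cdot> g \<cdot> k'"
    and perp_Rst: "f \<bottom> g \<Longrightarrow> \<rho> f \<bottom> \<rho> g"

locale perp_restriction_category =
  restriction_category_with_zeroes X + interference_relation X perp
  for X :: "('o, 'm, 'x) zcat_scheme" (structure)
    and perp :: "'m \<Rightarrow> 'm \<Rightarrow> bool"  (infix "\<bottom>" 50)

definition is_join :: "('o, 'm, 'x) rcat_scheme \<Rightarrow> 'm \<Rightarrow> 'm \<Rightarrow> 'm \<Rightarrow> bool" where
  "is_join X f g j \<longleftrightarrow>
     f \<sqsubseteq>\<^bsub>X\<^esub> j \<and> g \<sqsubseteq>\<^bsub>X\<^esub> j \<and> (\<forall>k. f \<sqsubseteq>\<^bsub>X\<^esub> k \<and> g \<sqsubseteq>\<^bsub>X\<^esub> k \<longrightarrow> j \<sqsubseteq>\<^bsub>X\<^esub> k)"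

text \<open>
  Least upper bounds are unique, so the equation \<open>h (f \<squnion> g) = h f \<squnion> h g\<close> says that
  \<open>h \<cdot> j\<close> is the join of \<open>h \<cdot> f\<close> and \<open>h \<cdot> g\<close>.
\<close>

definition has_binary_perp_joins ::
  "('o, 'm, 'x) rcat_scheme \<Rightarrow> ('m \<Rightarrow> 'm \<Rightarrow> bool) \<Rightarrow> bool" where
  "has_binary_perp_joins X perp \<longleftrightarrow>
     (\<forall>A B f g. f \<in> hom X A B \<and> g \<in> hom X A B \<and> perp f g \<longrightarrow>
        (\<exists>j. is_join X f g j \<and>
           (\<forall>A' h. h \<in> hom X A' A \<longrightarrow> is_join X (h \<cdot>\<^bsub>X\<^esub> f) (h \<cdot>\<^bsub>X\<^esub> g) (h \<cdot>\<^bsub>X\<^esub> j))))"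

end

theory Submission
  imports Defs
begin

text \<open>
  For \<open>f : A \<rightarrow> B + C\<close> the decision \<open>d\<close> of \<open>f\<close> has quasi-projections \<open>d \<iota>\<^sub>i\<^sup>\<circ> = \<rho> (f \<iota>\<^sub>i\<^sup>\<circ>)\<close>, and
  \<open>f\<close> is recovered as \<open>d\<close> followed by the copairing of the \<open>f \<iota>\<^sub>i\<^sup>\<circ> \<iota>\<^sub>i\<close>. It follows that the
  quasi-projections out of a binary coproduct are jointly monic, so that decisions are exactly the
  maps \<open>A \<rightarrow> A + A\<close> both of whose quasi-projections are restriction idempotents. Hence \<open>f : A \<rightarrow> B\<close>
  and \<open>g : A \<rightarrow> C\<close> are decision disjoint iff they are the two quasi-projections of a single map
  \<open>k : A \<rightarrow> B + C\<close>. In this form the interference axioms are transported along composition, and for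
  \<open>B = C\<close> the join of \<open>f\<close> and \<open>g\<close> is \<open>k \<nabla>\<close>.
\<close>

section \<open>Composition up to associativity\<close>

context category
begin

lemma hom_iff: "f \<in> hom X A B \<longleftrightarrow> f \<in> Arr X \<and> Dom X f = A \<and> Cod X f = B"
  by (simp add: hom_def)

lemma Ident_simps [simp]:
  assumes "A \<in> Obj X"
  shows "Ident X A \<in> Arr X" "Dom X (Ident X A) = A" "Cod X (Ident X A) = A"
  using Ident_hom[OF assms] by (simp_all add: hom_iff)

lemma Dom_Cod_Obj [simp]:
  assumes "f \<in> Arr X"
  shows "Dom X f \<in> Obj X" "Cod X f \<in> Obj X"
  using assms by (simp_all add: Dom_Obj Cod_Obj)

lemma Comp_simps [simp]:
  assumes "f \<in> Arr X" "g \<in> Arr X" "Cod X f = Dom X g"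
  shows "f \<cdot> g \<in> Arr X" "Dom X (f \<cdot> g) = Dom X f" "Cod X (f \<cdot> g) = Cod X g"
  using Comp_hom[of f "Dom X f" "Cod X f" g "Cod X g"] assms by (simp_all add: hom_iff)

lemma Ident_Comp_Arr [simp]: "f \<in> Arr X \<Longrightarrow> Dom X f = A \<Longrightarrow> Ident X A \<cdot> f = f"
  using Ident_Comp[of f A "Cod X f"] by (simp add: hom_iff)

lemma Comp_Ident_Arr [simp]: "f \<in> Arr X \<Longrightarrow> Cod X f = A \<Longrightarrow> f \<cdot> Ident X A = f"
  using Comp_Ident[of f "Dom X f" A] by (simp add: hom_iff)

lemma Comp_assoc_Arr [simp]:
  assumes "f \<in> Arr X" "g \<in> Arr X" "h \<in> Arr X" "Cod X f = Dom X g" "Cod X g = Dom X h"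
  shows "(f \<cdot> g) \<cdot> h = f \<cdot> (g \<cdot> h)"
  using Comp_assoc[of f "Dom X f" "Cod X f" g "Cod X g" h "Cod X h"] assms by (simp add: hom_iff)

text \<open>Simplification brackets composites to the right, so a known equation between two-step
  composites no longer matches inside a longer one. This form, like \<open>Comp_eq_extend\<close>,
  carries the tail \<open>h\<close> along.\<close>

lemma Comp_eq_Comp_extend:
  assumes "f \<cdot> g = f' \<cdot> g'" "f \<in> Arr X" "g \<in> Arr X" "f' \<in> Arr X" "g' \<in> Arr X" "h \<in> Arr X"
    and "Cod X f = Dom X g" "Cod X f' = Dom X g'" "Cod X g = Dom X h" "Cod X g' = Dom X h"
  shows "f \<cdot> (g \<cdot> h) = f' \<cdot> (g' \<cdot> h)"
  using assms by (metis Comp_assoc_Arr)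

lemma Comp_eq_extend:
  assumes "f \<cdot> g = k" "f \<in> Arr X" "g \<in> Arr X" "h \<in> Arr X"
    and "Cod X f = Dom X g" "Cod X g = Dom X h"
  shows "f \<cdot> (g \<cdot> h) = k \<cdot> h"
  using assms by (metis Comp_assoc_Arr)

end

section \<open>Calculus of restrictions and of the order\<close>

context restriction_category
begin

lemma Rst_simps [simp]:
  assumes "f \<in> Arr X"
  shows "\<rho> f \<in> Arr X" "Dom X (\<rho> f) = Dom X f" "Cod X (\<rho> f) = Dom X f"
  using Rst_hom[of f "Dom X f" "Cod X f"] assms by (simp_all add: hom_iff)

lemma Rst_Comp_Arr [simp]: "f \<in> Arr X \<Longrightarrow> \<rho> f \<cdot> f = f"
  using Rst_Comp[of f "Dom X f" "Cod X f"] by (simp add: hom_iff)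

lemma Rst_Comp_extend [simp]:
  "f \<in> Arr X \<Longrightarrow> h \<in> Arr X \<Longrightarrow> Cod X f = Dom X h \<Longrightarrow> \<rho> f \<cdot> (f \<cdot> h) = f \<cdot> h"
  by (rule Comp_eq_extend) simp_all

lemma Rst_commute_Arr:
  "f \<in> Arr X \<Longrightarrow> g \<in> Arr X \<Longrightarrow> Dom X f = Dom X g \<Longrightarrow> \<rho> f \<cdot> \<rho> g = \<rho> g \<cdot> \<rho> f"
  by (rule Rst_commute) (auto simp: hom_iff)

lemma Rst_Rst_Comp_Arr:
  "f \<in> Arr X \<Longrightarrow> g \<in> Arr X \<Longrightarrow> Dom X f = Dom X g \<Longrightarrow> \<rho> (\<rho> g \<cdot> f) = \<rho> g \<cdot> \<rho> f"
  by (rule Rst_Rst_Comp) (auto simp: hom_iff)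

lemma Comp_Rst_Arr:
  "f \<in> Arr X \<Longrightarrow> g \<in> Arr X \<Longrightarrow> Cod X f = Dom X g \<Longrightarrow> f \<cdot> \<rho> g = \<rho> (f \<cdot> g) \<cdot> f"
  by (rule Comp_Rst) (auto simp: hom_iff)

lemma Rst_Ident [simp]: "A \<in> Obj X \<Longrightarrow> \<rho> (Ident X A) = Ident X A"
  using Rst_Comp_Arr[of "Ident X A"] Comp_Ident_Arr[of "\<rho> (Ident X A)" A] by simp

lemma Rst_Rst [simp]: "f \<in> Arr X \<Longrightarrow> \<rho> (\<rho> f) = \<rho> f"
  using Rst_Rst_Comp_Arr[of "Ident X (Dom X f)" f] by simp

lemma Rst_idem [simp]: "f \<in> Arr X \<Longrightarrow> \<rho> f \<cdot> \<rho> f = \<rho> f"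
  using Rst_Rst_Comp_Arr[of f f] by simp

text \<open>\<open>Comp_Rst\<close> turns the argument into
  \<open>\<rho> (f \<cdot> g) \<cdot> f\<close>, and \<open>\<rho> (f \<cdot> g)\<close> already
  absorbs \<open>\<rho> f\<close>.\<close>

lemma Rst_Comp_Rst_right:
  assumes "f \<in> Arr X" "g \<in> Arr X" "Cod X f = Dom X g"
  shows "\<rho> (f \<cdot> \<rho> g) = \<rho> (f \<cdot> g)"
proof -
  have "\<rho> (f \<cdot> \<rho> g) = \<rho> (f \<cdot> g) \<cdot> \<rho> f"
    using assms Comp_Rst_Arr[of f g] by (simp add: Rst_Rst_Comp_Arr)
  also have "\<dots> = \<rho> f \<cdot> \<rho> (f \<cdot> g)"
    using assms by (simp add: Rst_commute_Arr)
  also have "\<dots> = \<rho> (f \<cdot> g)"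
    using assms Rst_Rst_Comp_Arr[of "f \<cdot> g" f] by simp
  finally show ?thesis .
qed

lemma Rst_Comp_total:
  assumes "f \<in> Arr X" "g \<in> Arr X" "Cod X f = Dom X g" "\<rho> g = Ident X (Dom X g)"
  shows "\<rho> (f \<cdot> g) = \<rho> f"
  using Rst_Comp_Rst_right[of f g] assms by simp

lemma rle_Rst_absorb:
  assumes "f \<sqsubseteq> g"
  shows "\<rho> g \<cdot> f = f"
proof -
  have *: "f \<in> Arr X" "g \<in> Arr X" "Dom X f = Dom X g" "\<rho> f \<cdot> g = f"
    using assms by (auto simp: rle_def)
  have "\<rho> g \<cdot> f = (\<rho> g \<cdot> \<rho> f) \<cdot> g"
    using * by simp
  also have "\<dots> = (\<rho> f \<cdot> \<rho> g) \<cdot> g"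
    using * by (simp add: Rst_commute_Arr)
  also have "\<dots> = f"
    using * by simp
  finally show ?thesis .
qed

lemma rle_Comp_left:
  assumes "f \<sqsubseteq> g" "h \<in> Arr X" "Cod X h = Dom X f"
  shows "h \<cdot> f \<sqsubseteq> h \<cdot> g"
proof -
  have *: "f \<in> Arr X" "g \<in> Arr X" "Dom X f = Dom X g" "Cod X f = Cod X g" "\<rho> f \<cdot> g = f"
    using assms by (auto simp: rle_def)
  have "\<rho> (h \<cdot> f) \<cdot> (h \<cdot> g) = h \<cdot> (\<rho> f \<cdot> g)"
    using Comp_eq_Comp_extend[OF Comp_Rst_Arr[of h f], of g] * assms by simp
  then show ?thesis
    using * assms by (simp add: rle_def)
qed

lemma Rst_Comp_rle:
  assumes "e \<in> Arr X" "f \<in> Arr X" "Dom X e = Dom X f"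
  shows "\<rho> e \<cdot> f \<sqsubseteq> f"
  using assms by (simp add: rle_def Rst_Rst_Comp_Arr)

end

section \<open>Binary coproducts, quasi-projections and the codiagonal\<close>

context extensive_restriction_category
begin

abbreviation coprod2 :: "'o \<Rightarrow> 'o \<Rightarrow> 'o"  (infixl "\<oplus>" 65) where
  "A \<oplus> B \<equiv> Copr X [A, B]"

definition inj0 :: "'o \<Rightarrow> 'o \<Rightarrow> 'm" where "inj0 A B = Inj X [A, B] 0"
definition inj1 :: "'o \<Rightarrow> 'o \<Rightarrow> 'm" where "inj1 A B = Inj X [A, B] (Suc 0)"
definition proj0 :: "'o \<Rightarrow> 'o \<Rightarrow> 'm" where "proj0 A B = quasi_proj X [A, B] 0"
definition proj1 :: "'o \<Rightarrow> 'o \<Rightarrow> 'm" where "proj1 A B = quasi_proj X [A, B] (Suc 0)"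

text \<open>The copairing of two maps with a common codomain; the codomain is read off
  \<open>f\<close>, so the value is meaningful only if \<open>g\<close> shares it.\<close>

definition copair :: "'m \<Rightarrow> 'm \<Rightarrow> 'm" where
  "copair f g = cotuple X [Dom X f, Dom X g] (Cod X f) (\<lambda>i. if i = 0 then f else g)"

lemma Zero_simps [simp]:
  assumes "A \<in> Obj X" "B \<in> Obj X"
  shows "Zero X A B \<in> Arr X" "Dom X (Zero X A B) = A" "Cod X (Zero X A B) = B"
  using Zero_hom[OF assms] by (simp_all add: hom_iff)

lemma Comp_Zero_Arr [simp]:
  "f \<in> Arr X \<Longrightarrow> Cod X f = B \<Longrightarrow> C \<in> Obj X \<Longrightarrow> f \<cdot> Zero X B C = Zero X (Dom X f) C"
  using Comp_Zero[of f "Dom X f" B C] by (simp add: hom_iff)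

lemma Zero_Comp_Arr [simp]:
  "f \<in> Arr X \<Longrightarrow> Dom X f = A \<Longrightarrow> C \<in> Obj X \<Longrightarrow> Zero X C A \<cdot> f = Zero X C (Cod X f)"
  using Zero_Comp[of C f A "Cod X f"] by (simp add: hom_iff)

declare Rst_Zero [simp]

lemma coprod2_Obj [simp]: "A \<in> Obj X \<Longrightarrow> B \<in> Obj X \<Longrightarrow> A \<oplus> B \<in> Obj X"
  by (simp add: Copr_Obj)

lemma inj_simps [simp]:
  assumes "A \<in> Obj X" "B \<in> Obj X"
  shows "inj0 A B \<in> Arr X" "Dom X (inj0 A B) = A" "Cod X (inj0 A B) = A \<oplus> B"
    and "inj1 A B \<in> Arr X" "Dom X (inj1 A B) = B" "Cod X (inj1 A B) = A \<oplus> B"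
  using Inj_hom[of "[A, B]" 0] Inj_hom[of "[A, B]" "Suc 0"] assms
  by (simp_all add: hom_iff inj0_def inj1_def)

lemma Rst_inj [simp]:
  assumes "A \<in> Obj X" "B \<in> Obj X"
  shows "\<rho> (inj0 A B) = Ident X A" "\<rho> (inj1 A B) = Ident X B"
  using Inj_total[of "[A, B]" 0] Inj_total[of "[A, B]" "Suc 0"] inj_simps[OF assms] assms
  by (simp_all add: total_def inj0_def inj1_def)

lemma cotuple2:
  assumes "A \<in> Obj X" "B \<in> Obj X" "fs 0 \<in> hom X A C" "fs (Suc 0) \<in> hom X B C"
  shows "cotuple X [A, B] C fs \<in> hom X (A \<oplus> B) C
    \<and> inj0 A B \<cdot> cotuple X [A, B] C fs = fs 0
    \<and> inj1 A B \<cdot> cotuple X [A, B] C fs = fs (Suc 0)"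
proof -
  have "C \<in> Obj X"
    using assms by (auto simp: hom_iff)
  then have "\<exists>!h. h \<in> hom X (A \<oplus> B) C \<and> (\<forall>i < length [A, B]. Inj X [A, B] i \<cdot> h = fs i)"
    using assms by (intro Copr_universal) (auto simp: less_Suc_eq)
  from theI'[OF this] show ?thesis
    by (simp add: cotuple_def inj0_def inj1_def)
qed

lemma coprod2_ext:
  assumes "A \<in> Obj X" "B \<in> Obj X" "h \<in> Arr X" "h' \<in> Arr X" "Dom X h = A \<oplus> B" "Dom X h' = A \<oplus> B"
    and "Cod X h = Cod X h'"
    and "inj0 A B \<cdot> h = inj0 A B \<cdot> h'" "inj1 A B \<cdot> h = inj1 A B \<cdot> h'"
  shows "h = h'"
proof -
  \<comment> \<open>\<open>P\<close> is the defining property of the cotuple of the two restrictions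
    of \<open>h\<close> to the summands; \<open>h\<close> and \<open>h'\<close> both have
    it.\<close>
  define P where "P k \<longleftrightarrow> k \<in> hom X (A \<oplus> B) (Cod X h) \<and>
      (\<forall>i < length [A, B]. Inj X [A, B] i \<cdot> k = (if i = 0 then inj0 A B \<cdot> h else inj1 A B \<cdot> h))"
    for k
  have "\<exists>!k. P k"
    unfolding P_def using assms by (intro Copr_universal) (auto simp: less_Suc_eq hom_iff)
  moreover have "P h" "P h'"
    using assms by (auto simp: P_def less_Suc_eq hom_iff inj0_def inj1_def)
  ultimately show ?thesis
    by blast
qed

lemma copair_simps [simp]:
  assumes "f \<in> Arr X" "g \<in> Arr X" "Cod X f = Cod X g"
  shows "copair f g \<in> Arr X" "Dom X (copair f g) = Dom X f \<oplus> Dom X g"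
    and "Cod X (copair f g) = Cod X f"
  using cotuple2[of "Dom X f" "Dom X g" "\<lambda>i. if i = 0 then f else g" "Cod X f"] assms
  by (simp_all add: hom_iff copair_def)

lemma inj_copair [simp]:
  assumes "f \<in> Arr X" "g \<in> Arr X" "Cod X f = Cod X g" "Dom X f = A" "Dom X g = B"
  shows "inj0 A B \<cdot> copair f g = f" "inj1 A B \<cdot> copair f g = g"
  using cotuple2[of "Dom X f" "Dom X g" "\<lambda>i. if i = 0 then f else g" "Cod X f"] assms
  by (auto simp: hom_iff copair_def)

lemma inj_copair_extend [simp]:
  assumes "f \<in> Arr X" "g \<in> Arr X" "Cod X f = Cod X g" "Dom X f = A" "Dom X g = B"
    and "h \<in> Arr X" "Dom X h = Cod X f"
  shows "inj0 A B \<cdot> (copair f g \<cdot> h) = f \<cdot> h" "inj1 A B \<cdot> (copair f g \<cdot> h) = g \<cdot> h"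
proof -
  have [simp]: "A \<in> Obj X" "B \<in> Obj X"
    using assms by auto
  show "inj0 A B \<cdot> (copair f g \<cdot> h) = f \<cdot> h" "inj1 A B \<cdot> (copair f g \<cdot> h) = g \<cdot> h"
    by (rule Comp_eq_extend; use assms in simp)+
qed

lemma cotuple2_eq_copair:
  assumes "A \<in> Obj X" "B \<in> Obj X" "fs 0 \<in> hom X A C" "fs (Suc 0) \<in> hom X B C"
  shows "cotuple X [A, B] C fs = copair (fs 0) (fs (Suc 0))"
proof (rule coprod2_ext[of A B])
  note assms[unfolded hom_iff, simp] cotuple2[OF assms, unfolded hom_iff, simp]
  show "cotuple X [A, B] C fs \<in> Arr X" "copair (fs 0) (fs (Suc 0)) \<in> Arr X"
    "Dom X (cotuple X [A, B] C fs) = A \<oplus> B" "Dom X (copair (fs 0) (fs (Suc 0))) = A \<oplus> B"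
    "Cod X (cotuple X [A, B] C fs) = Cod X (copair (fs 0) (fs (Suc 0)))"
    "inj0 A B \<cdot> cotuple X [A, B] C fs = inj0 A B \<cdot> copair (fs 0) (fs (Suc 0))"
    "inj1 A B \<cdot> cotuple X [A, B] C fs = inj1 A B \<cdot> copair (fs 0) (fs (Suc 0))"
    by simp_all
qed (fact assms)+

lemma proj_eq_copair:
  assumes "A \<in> Obj X" "B \<in> Obj X"
  shows "proj0 A B = copair (Ident X A) (Zero X B A)" "proj1 A B = copair (Zero X A B) (Ident X B)"
  using assms unfolding proj0_def proj1_def quasi_proj_def
  by (subst cotuple2_eq_copair; simp add: hom_iff)+

lemma proj_simps [simp]:
  assumes "A \<in> Obj X" "B \<in> Obj X"
  shows "proj0 A B \<in> Arr X" "Dom X (proj0 A B) = A \<oplus> B" "Cod X (proj0 A B) = A"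
    and "proj1 A B \<in> Arr X" "Dom X (proj1 A B) = A \<oplus> B" "Cod X (proj1 A B) = B"
  using assms by (simp_all add: proj_eq_copair)

lemma inj_proj [simp]:
  assumes "A \<in> Obj X" "B \<in> Obj X"
  shows "inj0 A B \<cdot> proj0 A B = Ident X A" "inj0 A B \<cdot> proj1 A B = Zero X A B"
    and "inj1 A B \<cdot> proj0 A B = Zero X B A" "inj1 A B \<cdot> proj1 A B = Ident X B"
  using assms by (simp_all add: proj_eq_copair)

lemma inj_proj_extend [simp]:
  assumes "A \<in> Obj X" "B \<in> Obj X" "h \<in> Arr X"
  shows "Dom X h = A \<Longrightarrow> inj0 A B \<cdot> (proj0 A B \<cdot> h) = h"
    and "Dom X h = B \<Longrightarrow> inj0 A B \<cdot> (proj1 A B \<cdot> h) = Zero X A (Cod X h)"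
    and "Dom X h = A \<Longrightarrow> inj1 A B \<cdot> (proj0 A B \<cdot> h) = Zero X B (Cod X h)"
    and "Dom X h = B \<Longrightarrow> inj1 A B \<cdot> (proj1 A B \<cdot> h) = h"
  using assms Comp_eq_extend[OF inj_proj(1)[OF assms(1,2)], of h]
    Comp_eq_extend[OF inj_proj(2)[OF assms(1,2)], of h]
    Comp_eq_extend[OF inj_proj(3)[OF assms(1,2)], of h]
    Comp_eq_extend[OF inj_proj(4)[OF assms(1,2)], of h]
  by simp_all

lemma copair_Comp:
  assumes "f \<in> Arr X" "g \<in> Arr X" "Cod X f = Cod X g" "h \<in> Arr X" "Dom X h = Cod X f"
  shows "copair f g \<cdot> h = copair (f \<cdot> h) (g \<cdot> h)"
  by (rule coprod2_ext[of "Dom X f" "Dom X g"]) (use assms in \<open>simp_all\<close>)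

lemma copair_inj_proj:
  assumes "f \<in> Arr X" "g \<in> Arr X" "Cod X f = A" "Cod X g = B"
  shows "copair (f \<cdot> inj0 A B) (g \<cdot> inj1 A B) \<cdot> proj0 A B = proj0 (Dom X f) (Dom X g) \<cdot> f"
    and "copair (f \<cdot> inj0 A B) (g \<cdot> inj1 A B) \<cdot> proj1 A B = proj1 (Dom X f) (Dom X g) \<cdot> g"
proof -
  have [simp]: "A \<in> Obj X" "B \<in> Obj X"
    using assms by auto
  show "copair (f \<cdot> inj0 A B) (g \<cdot> inj1 A B) \<cdot> proj0 A B = proj0 (Dom X f) (Dom X g) \<cdot> f"
    "copair (f \<cdot> inj0 A B) (g \<cdot> inj1 A B) \<cdot> proj1 A B = proj1 (Dom X f) (Dom X g) \<cdot> g"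
    by (rule coprod2_ext[of "Dom X f" "Dom X g"]; use assms in simp)+
qed

text \<open>Tested on the summands: \<open>Comp_Rst\<close> moves the restriction past each
  injection, where only \<open>\<rho> f\<close> or \<open>\<rho> g\<close> remains.\<close>

lemma Rst_copair:
  assumes "f \<in> Arr X" "g \<in> Arr X" "Cod X f = Cod X g" "Dom X f = A" "Dom X g = B"
  shows "\<rho> (copair f g) = copair (\<rho> f \<cdot> inj0 A B) (\<rho> g \<cdot> inj1 A B)"
proof -
  have [simp]: "A \<in> Obj X" "B \<in> Obj X"
    using assms by auto
  show ?thesis
    by (rule coprod2_ext[of A B])
      (use assms Comp_Rst_Arr[of "inj0 A B" "copair f g"] Comp_Rst_Arr[of "inj1 A B" "copair f g"]
        in simp_all)
qed

text \<open>The codiagonal \<open>codiag X 2 A\<close>, written as a copairing.\<close>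

definition fold2 :: "'o \<Rightarrow> 'm" where "fold2 A = copair (Ident X A) (Ident X A)"

lemma fold2_simps [simp]:
  assumes "A \<in> Obj X"
  shows "fold2 A \<in> Arr X" "Dom X (fold2 A) = A \<oplus> A" "Cod X (fold2 A) = A"
    and "inj0 A A \<cdot> fold2 A = Ident X A" "inj1 A A \<cdot> fold2 A = Ident X A"
  using assms by (simp_all add: fold2_def)

text \<open>A quasi-projection is the codiagonal cut down to one summand: by
  \<open>Rst_copair\<close> its restriction is the identity on that summand and zero on the
  other.\<close>

lemma proj_rle_fold2:
  assumes "A \<in> Obj X"
  shows "proj0 A A \<sqsubseteq> fold2 A" "proj1 A A \<sqsubseteq> fold2 A"
proof -
  have "\<rho> (proj0 A A) \<cdot> fold2 A = proj0 A A"
    by (rule coprod2_ext[of A A]) (use assms in \<open>simp_all add: proj_eq_copair Rst_copair\<close>)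
  moreover have "\<rho> (proj1 A A) \<cdot> fold2 A = proj1 A A"
    by (rule coprod2_ext[of A A]) (use assms in \<open>simp_all add: proj_eq_copair Rst_copair\<close>)
  ultimately show "proj0 A A \<sqsubseteq> fold2 A" "proj1 A A \<sqsubseteq> fold2 A"
    using assms by (simp_all add: rle_def)
qed

section \<open>Decisions of maps into a binary coproduct\<close>

lemma decides2_iff:
  assumes "f \<in> hom X A (B \<oplus> C)" "B \<in> Obj X" "C \<in> Obj X"
  shows "decides X [B, C] f d \<longleftrightarrow>
    d \<in> hom X A (A \<oplus> A) \<and> d \<cdot> fold2 A = \<rho> f \<and>
    d \<cdot> copair (f \<cdot> inj0 (B \<oplus> C) (B \<oplus> C)) (f \<cdot> inj1 (B \<oplus> C) (B \<oplus> C)) =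
    f \<cdot> copair (inj0 B C \<cdot> inj0 (B \<oplus> C) (B \<oplus> C)) (inj1 B C \<cdot> inj1 (B \<oplus> C) (B \<oplus> C))"
proof -
  have A: "A \<in> Obj X" "f \<in> Arr X" "Dom X f = A" "Cod X f = B \<oplus> C"
    using assms by (auto simp: hom_iff)
  have inj: "Inj X [D, E] 0 = inj0 D E" "Inj X [D, E] (Suc 0) = inj1 D E" for D E
    by (simp_all add: inj0_def inj1_def)
  have "codiag X 2 A = fold2 A"
    using A by (simp add: codiag_def fold2_def numeral_2_eq_2 cotuple2_eq_copair hom_iff)
  moreover have "copr_map X [A, A] [B \<oplus> C, B \<oplus> C] (\<lambda>i. f) =
      copair (f \<cdot> inj0 (B \<oplus> C) (B \<oplus> C)) (f \<cdot> inj1 (B \<oplus> C) (B \<oplus> C))"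
    using A assms by (simp add: copr_map_def cotuple2_eq_copair hom_iff inj)
  moreover have "copr_map X [B, C] [B \<oplus> C, B \<oplus> C] (Inj X [B, C]) =
      copair (inj0 B C \<cdot> inj0 (B \<oplus> C) (B \<oplus> C)) (inj1 B C \<cdot> inj1 (B \<oplus> C) (B \<oplus> C))"
    using A assms by (simp add: copr_map_def cotuple2_eq_copair hom_iff inj)
  ultimately show ?thesis
    using A by (auto simp: decides_def Let_def numeral_2_eq_2)
qed

text \<open>Following the second decision equation by a quasi-projection of
  \<open>?T \<oplus> ?T\<close> selects one copy and yields \<open>d \<cdot> (proj0 A A \<cdot> f) =
  f \<cdot> (proj0 B C \<cdot> inj0 B C)\<close>, and likewise for the other copy. The first
  equation then forces \<open>d \<cdot> proj0 A A\<close> and \<open>d \<cdot> proj1 A A\<close> to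
  be restriction idempotents.\<close>

lemma decides_proj:
  assumes f: "f \<in> hom X A (B \<oplus> C)" and [simp]: "B \<in> Obj X" "C \<in> Obj X"
    and "decides X [B, C] f d"
  shows "d \<in> hom X A (A \<oplus> A)" "d \<cdot> fold2 A = \<rho> f"
    and "d \<cdot> proj0 A A = \<rho> (f \<cdot> proj0 B C)" "d \<cdot> proj1 A A = \<rho> (f \<cdot> proj1 B C)"
    and "\<rho> (f \<cdot> proj0 B C) \<cdot> f = f \<cdot> (proj0 B C \<cdot> inj0 B C)"
    and "\<rho> (f \<cdot> proj1 B C) \<cdot> f = f \<cdot> (proj1 B C \<cdot> inj1 B C)"
    and "f = d \<cdot> copair (f \<cdot> (proj0 B C \<cdot> inj0 B C)) (f \<cdot> (proj1 B C \<cdot> inj1 B C))"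
proof -
  let ?T = "B \<oplus> C"
  let ?L = "copair (f \<cdot> inj0 ?T ?T) (f \<cdot> inj1 ?T ?T)"
  let ?R = "copair (inj0 B C \<cdot> inj0 ?T ?T) (inj1 B C \<cdot> inj1 ?T ?T)"
  have f' [simp]: "f \<in> Arr X" "Dom X f = A" "Cod X f = ?T" "A \<in> Obj X"
    using f by (auto simp: hom_iff)
  have d: "d \<in> hom X A (A \<oplus> A)" and fold: "d \<cdot> fold2 A = \<rho> f" and eq: "d \<cdot> ?L = f \<cdot> ?R"
    using assms by (simp_all add: decides2_iff[OF f])
  then have [simp]: "d \<in> Arr X" "Dom X d = A" "Cod X d = A \<oplus> A"
    by (auto simp: hom_iff)
  show "d \<in> hom X A (A \<oplus> A)" "d \<cdot> fold2 A = \<rho> f"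
    by fact+
  have ext: "d \<cdot> (?L \<cdot> h) = f \<cdot> (?R \<cdot> h)" if "h \<in> Arr X" "Dom X h = ?T \<oplus> ?T" for h
    by (rule Comp_eq_Comp_extend[OF eq]) (use that in simp_all)
  have p0: "d \<cdot> (proj0 A A \<cdot> f) = f \<cdot> (proj0 B C \<cdot> inj0 B C)"
    using ext[of "proj0 ?T ?T"] by (simp add: copair_inj_proj)
  have p1: "d \<cdot> (proj1 A A \<cdot> f) = f \<cdot> (proj1 B C \<cdot> inj1 B C)"
    using ext[of "proj1 ?T ?T"] by (simp add: copair_inj_proj)
  \<comment> \<open>Since \<open>d \<cdot> p\<close> lies below
    \<open>d \<cdot> fold2 A = \<rho> f\<close>, it is itself a restriction, hence fixed by \<rho>;
    the inner \<rho> can therefore be dropped.\<close>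
  have *: "d \<cdot> p = \<rho> (d \<cdot> p \<cdot> f)" if "p \<sqsubseteq> fold2 A" for p
  proof -
    have [simp]: "p \<in> Arr X" "Dom X p = A \<oplus> A" "Cod X p = A"
      using that by (auto simp: rle_def)
    have "d \<cdot> p = \<rho> (d \<cdot> p) \<cdot> \<rho> f"
      using rle_Comp_left[OF that, of d] fold by (simp add: rle_def)
    also have "\<dots> = \<rho> (\<rho> (d \<cdot> p) \<cdot> f)"
      by (simp add: Rst_Rst_Comp_Arr)
    finally have e: "d \<cdot> p = \<rho> (\<rho> (d \<cdot> p) \<cdot> f)" .
    then have r: "\<rho> (d \<cdot> p) = d \<cdot> p"
      using Rst_Rst[of "\<rho> (d \<cdot> p) \<cdot> f"] by simp
    show ?thesis
      using e unfolding r .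
  qed
  show d0: "d \<cdot> proj0 A A = \<rho> (f \<cdot> proj0 B C)"
    using *[OF proj_rle_fold2(1)] p0 Rst_Comp_total[of "f \<cdot> proj0 B C" "inj0 B C"] by simp
  show d1: "d \<cdot> proj1 A A = \<rho> (f \<cdot> proj1 B C)"
    using *[OF proj_rle_fold2(2)] p1 Rst_Comp_total[of "f \<cdot> proj1 B C" "inj1 B C"] by simp
  show "\<rho> (f \<cdot> proj0 B C) \<cdot> f = f \<cdot> (proj0 B C \<cdot> inj0 B C)"
    "\<rho> (f \<cdot> proj1 B C) \<cdot> f = f \<cdot> (proj1 B C \<cdot> inj1 B C)"
    using p0 p1 by (simp_all flip: d0 d1)
  \<comment> \<open>\<open>?h\<close> keeps the \<open>B\<close> part of the first copy of
    \<open>?T\<close> and the \<open>C\<close> part of the second. As \<open>?R\<close> sends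
    \<open>B\<close> and \<open>C\<close> exactly there, \<open>?h\<close> is a left inverse of
    nothing but \<open>?R\<close> followed by it is the identity.\<close>
  let ?h = "copair (proj0 B C \<cdot> inj0 B C) (proj1 B C \<cdot> inj1 B C)"
  have "?L \<cdot> ?h = copair (f \<cdot> (proj0 B C \<cdot> inj0 B C)) (f \<cdot> (proj1 B C \<cdot> inj1 B C))"
    by (simp add: copair_Comp)
  moreover have "?R \<cdot> ?h = Ident X ?T"
    by (rule coprod2_ext[of B C]) simp_all
  ultimately show "f = d \<cdot> copair (f \<cdot> (proj0 B C \<cdot> inj0 B C)) (f \<cdot> (proj1 B C \<cdot> inj1 B C))"
    using ext[of ?h] by simp
qed

lemma obtain_decision:
  assumes "f \<in> hom X A (B \<oplus> C)" "B \<in> Obj X" "C \<in> Obj X"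
  obtains d where "decides X [B, C] f d"
  using decision_exists[of "[B, C]" f A] assms by auto

text \<open>Restricting \<open>f\<close> to where it lands in one summand makes it factor through
  that injection, which the opposite quasi-projection sends to zero.\<close>

lemma proj_orthogonal:
  assumes f: "f \<in> hom X A (B \<oplus> C)" and [simp]: "B \<in> Obj X" "C \<in> Obj X"
  shows "\<rho> (f \<cdot> proj0 B C) \<cdot> (f \<cdot> proj1 B C) = Zero X A C"
    and "\<rho> (f \<cdot> proj1 B C) \<cdot> (f \<cdot> proj0 B C) = Zero X A B"
proof -
  have f' [simp]: "f \<in> Arr X" "Dom X f = A" "Cod X f = B \<oplus> C" "A \<in> Obj X"
    using f by (auto simp: hom_iff)
  obtain d where d: "decides X [B, C] f d"
    using obtain_decision[OF f] by auto
  show "\<rho> (f \<cdot> proj0 B C) \<cdot> (f \<cdot> proj1 B C) = Zero X A C"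
    using Comp_eq_Comp_extend[OF decides_proj(5)[OF f _ _ d], of "proj1 B C"] by simp
  show "\<rho> (f \<cdot> proj1 B C) \<cdot> (f \<cdot> proj0 B C) = Zero X A B"
    using Comp_eq_Comp_extend[OF decides_proj(6)[OF f _ _ d], of "proj0 B C"] by simp
qed

text \<open>In the reconstruction of \<open>k\<close> from its decision \<open>d\<close>, one
  component of the copairing vanishes, so the copairing factors through a quasi-projection of
  \<open>A \<oplus> A\<close>. The composite of \<open>d\<close> with that quasi-projection is a
  restriction, which the surviving component absorbs.\<close>

lemma factor_through_inj:
  assumes k: "k \<in> hom X A (B \<oplus> C)" and [simp]: "B \<in> Obj X" "C \<in> Obj X"
  shows "k \<cdot> proj1 B C = Zero X A C \<Longrightarrow> k = k \<cdot> (proj0 B C \<cdot> inj0 B C)"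
    and "k \<cdot> proj0 B C = Zero X A B \<Longrightarrow> k = k \<cdot> (proj1 B C \<cdot> inj1 B C)"
proof -
  have k' [simp]: "k \<in> Arr X" "Dom X k = A" "Cod X k = B \<oplus> C" "A \<in> Obj X"
    using k by (auto simp: hom_iff)
  obtain d where d: "decides X [B, C] k d"
    using obtain_decision[OF k] by auto
  note dp = decides_proj[OF k _ _ d, simplified]
  have [simp]: "d \<in> Arr X" "Dom X d = A" "Cod X d = A \<oplus> A"
    using dp(1) by (auto simp: hom_iff)
  show "k = k \<cdot> (proj0 B C \<cdot> inj0 B C)" if z: "k \<cdot> proj1 B C = Zero X A C"
  proof -
    let ?m = "k \<cdot> (proj0 B C \<cdot> inj0 B C)"
    have "k \<cdot> (proj1 B C \<cdot> inj1 B C) = Zero X A (B \<oplus> C)"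
      using Comp_eq_extend[OF z, of "inj1 B C"] by simp
    moreover have "copair ?m (Zero X A (B \<oplus> C)) = proj0 A A \<cdot> ?m"
      by (rule coprod2_ext[of A A]) simp_all
    ultimately have "k = d \<cdot> (proj0 A A \<cdot> ?m)"
      using dp(7) by simp
    also have "\<dots> = ?m"
      using Comp_eq_extend[OF dp(3), of ?m] Rst_Comp_extend[of "k \<cdot> proj0 B C" "inj0 B C"] by simp
    finally show ?thesis .
  qed
  show "k = k \<cdot> (proj1 B C \<cdot> inj1 B C)" if z: "k \<cdot> proj0 B C = Zero X A B"
  proof -
    let ?m = "k \<cdot> (proj1 B C \<cdot> inj1 B C)"
    have "k \<cdot> (proj0 B C \<cdot> inj0 B C) = Zero X A (B \<oplus> C)"
      using Comp_eq_extend[OF z, of "inj0 B C"] by simp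
    moreover have "copair (Zero X A (B \<oplus> C)) ?m = proj1 A A \<cdot> ?m"
      by (rule coprod2_ext[of A A]) simp_all
    ultimately have "k = d \<cdot> (proj1 A A \<cdot> ?m)"
      using dp(7) by simp
    also have "\<dots> = ?m"
      using Comp_eq_extend[OF dp(4), of ?m] Rst_Comp_extend[of "k \<cdot> proj1 B C" "inj1 B C"] by simp
    finally show ?thesis .
  qed
qed

section \<open>Joint monicity of the quasi-projections\<close>

text \<open>Reconstructing \<open>d\<close> from its own decision \<open>dd\<close> gives
  \<open>d = dd \<cdot> ?M\<close>, and \<open>?M\<close> is idempotent. This avoids assuming that
  \<open>d\<close> is its own decision, which is known only after joint monicity.\<close>

lemma decision_absorb:
  assumes f: "f \<in> hom X A (B \<oplus> C)" and [simp]: "B \<in> Obj X" "C \<in> Obj X"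
    and d: "decides X [B, C] f d"
  shows "d \<cdot> copair (\<rho> (f \<cdot> proj0 B C) \<cdot> inj0 A A) (\<rho> (f \<cdot> proj1 B C) \<cdot> inj1 A A) = d"
    (is "d \<cdot> ?M = d")
proof -
  have f' [simp]: "f \<in> Arr X" "Dom X f = A" "Cod X f = B \<oplus> C" "A \<in> Obj X"
    using f by (auto simp: hom_iff)
  note dp = decides_proj[OF f _ _ d, simplified]
  have [simp]: "d \<in> Arr X" "Dom X d = A" "Cod X d = A \<oplus> A"
    using dp(1) by (auto simp: hom_iff)
  obtain dd where dd: "decides X [A, A] d dd"
    using obtain_decision[OF dp(1)] by auto
  note ddp = decides_proj[OF dp(1) _ _ dd, simplified]
  have [simp]: "dd \<in> Arr X" "Dom X dd = A" "Cod X dd = A \<oplus> A"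
    using ddp(1) by (auto simp: hom_iff)
  have dM: "d = dd \<cdot> ?M"
    using ddp(7) Comp_eq_extend[OF dp(3), of "inj0 A A"] Comp_eq_extend[OF dp(4), of "inj1 A A"]
    by simp
  have MM: "?M \<cdot> ?M = ?M"
    by (rule coprod2_ext[of A A]) (simp_all add: Comp_eq_extend[OF Rst_idem])
  have "d \<cdot> ?M = dd \<cdot> (?M \<cdot> ?M)"
    by (subst dM) simp
  with dM MM show ?thesis
    by simp
qed

text \<open>\<open>\<rho> f \<cdot> d'\<close> is \<open>d \<cdot> (fold2 A \<cdot> d')\<close>.
  Because \<open>d\<close> absorbs \<open>?M\<close>, it suffices that \<open>?M\<close> is
  unchanged by \<open>fold2 A \<cdot> d'\<close>, which is checked on each copy of
  \<open>A\<close>.\<close>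

lemma decision_Rst_Comp:
  assumes f: "f \<in> hom X A (B \<oplus> C)" and g: "g \<in> hom X A (B \<oplus> C)"
    and [simp]: "B \<in> Obj X" "C \<in> Obj X"
    and eq: "f \<cdot> proj0 B C = g \<cdot> proj0 B C" "f \<cdot> proj1 B C = g \<cdot> proj1 B C"
    and d: "decides X [B, C] f d" and d': "decides X [B, C] g d'"
  shows "\<rho> f \<cdot> d' = d"
proof -
  let ?e0 = "\<rho> (g \<cdot> proj0 B C)" and ?e1 = "\<rho> (g \<cdot> proj1 B C)"
  let ?M = "copair (?e0 \<cdot> inj0 A A) (?e1 \<cdot> inj1 A A)"
  have [simp]: "f \<in> Arr X" "Dom X f = A" "Cod X f = B \<oplus> C" "A \<in> Obj X"
    "g \<in> Arr X" "Dom X g = A" "Cod X g = B \<oplus> C"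
    using f g by (auto simp: hom_iff)
  note dp = decides_proj[OF f _ _ d, simplified]
  note dp' = decides_proj[OF g _ _ d', simplified]
  have [simp]: "d \<in> Arr X" "Dom X d = A" "Cod X d = A \<oplus> A"
    "d' \<in> Arr X" "Dom X d' = A" "Cod X d' = A \<oplus> A"
    using dp(1) dp'(1) by (auto simp: hom_iff)
  have orth: "?e0 \<cdot> ?e1 = Zero X A A" "?e1 \<cdot> ?e0 = Zero X A A"
    using proj_orthogonal[OF dp'(1)] by (simp_all add: dp'(3,4))
  \<comment> \<open>The quasi-projections of \<open>?e0 \<cdot> d'\<close> are \<open>?e0\<close>
    and, by orthogonality, zero; so this map factors through the first injection.\<close>
  have k0: "?e0 \<cdot> d' = ?e0 \<cdot> inj0 A A"
    using factor_through_inj(1)[of "?e0 \<cdot> d'" A A A] orth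
      Comp_eq_extend[OF dp'(3), of "inj0 A A"]
    by (simp add: dp'(3,4) hom_iff Comp_eq_extend[OF Rst_idem])
  have k1: "?e1 \<cdot> d' = ?e1 \<cdot> inj1 A A"
    using factor_through_inj(2)[of "?e1 \<cdot> d'" A A A] orth
      Comp_eq_extend[OF dp'(4), of "inj1 A A"]
    by (simp add: dp'(3,4) hom_iff Comp_eq_extend[OF Rst_idem])
  have dM: "d \<cdot> ?M = d"
    using decision_absorb[OF f _ _ d] by (simp add: eq)
  have M: "?M \<cdot> (fold2 A \<cdot> d') = ?M"
    by (rule coprod2_ext[of A A]) (simp_all add: k0 k1 Comp_eq_extend[OF fold2_simps(4)]
        Comp_eq_extend[OF fold2_simps(5)])
  have "\<rho> f \<cdot> d' = d \<cdot> (fold2 A \<cdot> d')"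
    by (simp flip: dp(2))
  also have "\<dots> = d \<cdot> (?M \<cdot> (fold2 A \<cdot> d'))"
    using Comp_eq_extend[OF dM, of "fold2 A \<cdot> d'"] by simp
  also have "\<dots> = d"
    using M dM by simp
  finally show ?thesis .
qed

text \<open>A map is determined by its decision and its two quasi-projections, so it is enough that
  the decisions of \<open>f\<close> and \<open>g\<close> agree.\<close>

lemma proj_jointly_monic:
  assumes f: "f \<in> hom X A (B \<oplus> C)" and g: "g \<in> hom X A (B \<oplus> C)"
    and BC [simp]: "B \<in> Obj X" "C \<in> Obj X"
    and eq: "f \<cdot> proj0 B C = g \<cdot> proj0 B C" "f \<cdot> proj1 B C = g \<cdot> proj1 B C"
  shows "f = g"
proof -
  have [simp]: "f \<in> Arr X" "Dom X f = A" "Cod X f = B \<oplus> C" "A \<in> Obj X"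
    "g \<in> Arr X" "Dom X g = A" "Cod X g = B \<oplus> C"
    using f g by (auto simp: hom_iff)
  obtain d where d: "decides X [B, C] f d"
    using obtain_decision[OF f] by auto
  obtain d' where d': "decides X [B, C] g d'"
    using obtain_decision[OF g] by auto
  note dp = decides_proj[OF f _ _ d, simplified]
  note dp' = decides_proj[OF g _ _ d', simplified]
  have [simp]: "d \<in> Arr X" "Dom X d = A" "Cod X d = A \<oplus> A"
    "d' \<in> Arr X" "Dom X d' = A" "Cod X d' = A \<oplus> A"
    using dp(1) dp'(1) by (auto simp: hom_iff)
  have 1: "\<rho> f \<cdot> d' = d" and 2: "\<rho> g \<cdot> d = d'"
    using decision_Rst_Comp[OF f g BC eq d d'] decision_Rst_Comp[OF g f BC eq[symmetric] d' d]
    by auto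
  \<comment> \<open>Each decision is a restriction of the other; commuting \<open>\<rho> f\<close>
    and \<open>\<rho> g\<close> makes them equal.\<close>
  have "d = \<rho> f \<cdot> (\<rho> g \<cdot> d)"
    using 1 2 by simp
  also have "\<dots> = \<rho> g \<cdot> (\<rho> f \<cdot> d)"
    by (rule Comp_eq_Comp_extend[OF Rst_commute_Arr]) simp_all
  also have "\<rho> f \<cdot> d = d"
    using 1 Comp_eq_extend[OF Rst_idem, of f d'] by simp
  finally have "d = d'"
    using 2 by simp
  moreover have "f \<cdot> (proj0 B C \<cdot> inj0 B C) = g \<cdot> (proj0 B C \<cdot> inj0 B C)"
    by (rule Comp_eq_Comp_extend[OF eq(1)]) simp_all
  moreover have "f \<cdot> (proj1 B C \<cdot> inj1 B C) = g \<cdot> (proj1 B C \<cdot> inj1 B C)"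
    by (rule Comp_eq_Comp_extend[OF eq(2)]) simp_all
  ultimately show ?thesis
    using dp(7) dp'(7) by simp
qed

section \<open>Uniqueness of decisions and criteria for disjointness\<close>

text \<open>All candidates have the quasi-projections prescribed by \<open>decides_proj\<close>, so
  joint monicity identifies them.\<close>

lemma decision_of_eqI:
  assumes f: "f \<in> hom X A (B \<oplus> C)" and BC: "B \<in> Obj X" "C \<in> Obj X"
    and "decides X [B, C] f d"
  shows "decision_of X [B, C] f = d"
  unfolding decision_of_def
proof (rule the_equality)
  fix d' assume d': "decides X [B, C] f d'"
  have A: "A \<in> Obj X"
    using f by (auto simp: hom_iff)
  show "d' = d"
    using decides_proj[OF f BC d'] decides_proj[OF f BC assms(4)]
    by (intro proj_jointly_monic[of d' A A A d]) (simp_all add: A)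
qed fact

text \<open>The decision of \<open>d\<close> has quasi-projections
  \<open>\<rho> (d \<cdot> proj0 A A)\<close> and \<open>\<rho> (d \<cdot> proj1 A A)\<close>; by
  joint monicity it equals \<open>d\<close> iff these are the quasi-projections of
  \<open>d\<close>.\<close>

lemma is_decision_iff:
  assumes d: "d \<in> hom X A (A \<oplus> A)"
  shows "is_decision X 2 A d \<longleftrightarrow>
    \<rho> (d \<cdot> proj0 A A) = d \<cdot> proj0 A A \<and> \<rho> (d \<cdot> proj1 A A) = d \<cdot> proj1 A A"
proof -
  have A: "A \<in> Obj X"
    using d by (auto simp: hom_iff)
  obtain d' where d': "decides X [A, A] d d'"
    using obtain_decision[OF d A A] by auto
  note dp = decides_proj[OF d A A d']
  have "is_decision X 2 A d \<longleftrightarrow> d' = d"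
    using d decision_of_eqI[OF d A A d'] by (simp add: is_decision_def numeral_2_eq_2)
  also have "\<dots> \<longleftrightarrow> d' \<cdot> proj0 A A = d \<cdot> proj0 A A \<and> d' \<cdot> proj1 A A = d \<cdot> proj1 A A"
    using proj_jointly_monic[OF dp(1) d A A] by auto
  finally show ?thesis
    by (simp add: dp(3,4))
qed

lemma decision_disjoint_iff_Rst:
  assumes f: "f \<in> Arr X" "Dom X f = A" and g: "g \<in> Arr X" "Dom X g = A"
  shows "decision_disjoint X f g \<longleftrightarrow>
    (\<exists>d \<in> hom X A (A \<oplus> A). d \<cdot> proj0 A A = \<rho> f \<and> d \<cdot> proj1 A A = \<rho> g)"
proof -
  have "decision_disjoint X f g \<longleftrightarrow>
    (\<exists>d. is_decision X 2 A d \<and> d \<cdot> proj0 A A = \<rho> f \<and> d \<cdot> proj1 A A = \<rho> g)"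
    using f g by (simp add: decision_disjoint_def proj0_def proj1_def numeral_2_eq_2)
  moreover have "is_decision X 2 A d \<Longrightarrow> d \<in> hom X A (A \<oplus> A)" for d
    by (simp add: is_decision_def numeral_2_eq_2)
  moreover have "is_decision X 2 A d"
    if "d \<in> hom X A (A \<oplus> A)" "d \<cdot> proj0 A A = \<rho> f" "d \<cdot> proj1 A A = \<rho> g" for d
    using that f g by (simp add: is_decision_iff)
  ultimately show ?thesis
    by blast
qed

text \<open>From left to right \<open>k\<close> is \<open>d\<close> followed by
  \<open>f + g\<close>; from right to left \<open>d\<close> is the decision of
  \<open>k\<close>.\<close>

lemma decision_disjoint_iff:
  assumes f: "f \<in> hom X A B" and g: "g \<in> hom X A C"
  shows "decision_disjoint X f g \<longleftrightarrow>
    (\<exists>k \<in> hom X A (B \<oplus> C). k \<cdot> proj0 B C = f \<and> k \<cdot> proj1 B C = g)"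
proof
  have [simp]: "f \<in> Arr X" "Dom X f = A" "Cod X f = B" "g \<in> Arr X" "Dom X g = A" "Cod X g = C"
    "A \<in> Obj X" "B \<in> Obj X" "C \<in> Obj X"
    using f g by (auto simp: hom_iff)
  {
    assume "decision_disjoint X f g"
    then obtain d where d: "d \<in> hom X A (A \<oplus> A)" "d \<cdot> proj0 A A = \<rho> f" "d \<cdot> proj1 A A = \<rho> g"
      by (auto simp: decision_disjoint_iff_Rst[of f A g])
    then have [simp]: "d \<in> Arr X" "Dom X d = A" "Cod X d = A \<oplus> A"
      by (auto simp: hom_iff)
    let ?k = "d \<cdot> copair (f \<cdot> inj0 B C) (g \<cdot> inj1 B C)"
    have "?k \<in> hom X A (B \<oplus> C)"
      by (simp add: hom_iff)
    moreover have "?k \<cdot> proj0 B C = f" "?k \<cdot> proj1 B C = g"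
      using Comp_eq_extend[OF d(2), of f] Comp_eq_extend[OF d(3), of g]
      by (simp_all add: copair_inj_proj)
    ultimately show "\<exists>k \<in> hom X A (B \<oplus> C). k \<cdot> proj0 B C = f \<and> k \<cdot> proj1 B C = g"
      by blast
  next
    assume "\<exists>k \<in> hom X A (B \<oplus> C). k \<cdot> proj0 B C = f \<and> k \<cdot> proj1 B C = g"
    then obtain k where k: "k \<in> hom X A (B \<oplus> C)" "k \<cdot> proj0 B C = f" "k \<cdot> proj1 B C = g"
      by blast
    obtain d where "decides X [B, C] k d"
      using obtain_decision[OF k(1)] by auto
    from decides_proj[OF k(1) _ _ this] k show "decision_disjoint X f g"
      by (auto simp: decision_disjoint_iff_Rst[of f A g])
  }
qed

section \<open>Joins through the codiagonal\<close>

lemma proj_fold_is_join: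
  assumes k: "k \<in> hom X A (B \<oplus> B)" and [simp]: "B \<in> Obj X"
  shows "is_join X (k \<cdot> proj0 B B) (k \<cdot> proj1 B B) (k \<cdot> fold2 B)"
  unfolding is_join_def
proof (intro conjI allI impI)
  let ?f = "k \<cdot> proj0 B B" and ?g = "k \<cdot> proj1 B B"
  have [simp]: "k \<in> Arr X" "Dom X k = A" "Cod X k = B \<oplus> B" "A \<in> Obj X"
    using k by (auto simp: hom_iff)
  show "?f \<sqsubseteq> k \<cdot> fold2 B" "?g \<sqsubseteq> k \<cdot> fold2 B"
    by (auto intro!: rle_Comp_left proj_rle_fold2)
  fix m assume "?f \<sqsubseteq> m \<and> ?g \<sqsubseteq> m"
  then have [simp]: "m \<in> Arr X" "Dom X m = A" "Cod X m = B"
    and m: "\<rho> ?f \<cdot> m = ?f" "\<rho> ?g \<cdot> m = ?g"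
    by (auto simp: rle_def)
  obtain d where d: "decides X [B, B] k d"
    using obtain_decision[OF k] by auto
  note dp = decides_proj[OF k _ _ d, simplified]
  have [simp]: "d \<in> Arr X" "Dom X d = A" "Cod X d = A \<oplus> A"
    using dp(1) by (auto simp: hom_iff)
  let ?M = "copair (\<rho> ?f \<cdot> inj0 A A) (\<rho> ?g \<cdot> inj1 A A)"
  \<comment> \<open>For an upper bound \<open>m\<close>, both components of the reconstructed
    \<open>k\<close>, once folded, are restrictions of \<open>m\<close>. Hence \<open>m\<close> can
    be pulled out, and what precedes it collapses to \<open>\<rho> k\<close>.\<close>
  have "k \<cdot> fold2 B = d \<cdot> (copair (k \<cdot> (proj0 B B \<cdot> inj0 B B)) (k \<cdot> (proj1 B B \<cdot> inj1 B B)) \<cdot> fold2 B)"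
    using Comp_eq_extend[OF dp(7)[symmetric], of "fold2 B"] by simp
  also have "\<dots> = d \<cdot> (?M \<cdot> (fold2 A \<cdot> m))"
    using m by (simp add: copair_Comp Comp_eq_extend[OF fold2_simps(4)]
        Comp_eq_extend[OF fold2_simps(5)])
  also have "\<dots> = d \<cdot> (fold2 A \<cdot> m)"
    using Comp_eq_extend[OF decision_absorb[OF k _ _ d], of "fold2 A \<cdot> m"] by simp
  also have "\<dots> = \<rho> k \<cdot> m"
    using Comp_eq_extend[OF dp(2), of m] by simp
  finally show "k \<cdot> fold2 B \<sqsubseteq> m"
    using Rst_Comp_rle[of k m] by simp
qed

section \<open>The interference axioms and the existence of joins\<close>

lemma decision_disjoint_sym:
  assumes "decision_disjoint X f g"
  shows "decision_disjoint X g f"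
proof -
  have f: "f \<in> Arr X" "Dom X f = Dom X g" and g: "g \<in> Arr X"
    using assms by (auto simp: decision_disjoint_def)
  let ?A = "Dom X g" and ?B = "Cod X f" and ?C = "Cod X g"
  \<comment> \<open>The symmetry of the coproduct, which exchanges the quasi-projections.\<close>
  let ?s = "copair (inj1 ?C ?B) (inj0 ?C ?B)"
  have fh: "f \<in> hom X ?A ?B" and gh: "g \<in> hom X ?A ?C"
    using f g by (auto simp: hom_iff)
  obtain k where k: "k \<in> hom X ?A (?B \<oplus> ?C)" "k \<cdot> proj0 ?B ?C = f" "k \<cdot> proj1 ?B ?C = g"
    using assms decision_disjoint_iff[OF fh gh] by auto
  have "?s \<cdot> proj0 ?C ?B = proj1 ?B ?C" "?s \<cdot> proj1 ?C ?B = proj0 ?B ?C"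
    by (rule coprod2_ext[of ?B ?C]; use f g in simp)+
  with k f g show ?thesis
    by (intro decision_disjoint_iff[OF gh fh, THEN iffD2] bexI[of _ "k \<cdot> ?s"])
      (auto simp: hom_iff)
qed

lemma decision_disjoint_interference: "interference_relation X (decision_disjoint X)"
proof
  fix f g assume "decision_disjoint X f g"
  then show "f \<in> Arr X \<and> g \<in> Arr X \<and> Dom X f = Dom X g"
    by (simp add: decision_disjoint_def)
next
  fix A B assume "A \<in> Obj X" "B \<in> Obj X"
  then show "decision_disjoint X (Ident X A) (Zero X A B)"
    by (auto simp: decision_disjoint_iff[of _ A A _ B] hom_iff intro!: bexI[of _ "inj0 A B"])
next
  fix f g assume "decision_disjoint X f g"
  then show "decision_disjoint X g f"
    by (rule decision_disjoint_sym)
next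
  fix f assume ff: "decision_disjoint X f f"
  then have f: "f \<in> Arr X" "f \<in> hom X (Dom X f) (Cod X f)"
    by (auto simp: decision_disjoint_def hom_iff)
  with ff obtain k where "k \<in> hom X (Dom X f) (Cod X f \<oplus> Cod X f)"
    "k \<cdot> proj0 (Cod X f) (Cod X f) = f" "k \<cdot> proj1 (Cod X f) (Cod X f) = f"
    using decision_disjoint_iff[OF f(2) f(2)] by auto
  then show "f = Zero X (Dom X f) (Cod X f)"
    \<comment> \<open>Both quasi-projections of \<open>k\<close> are \<open>f\<close>, so
      orthogonality reads \<open>\<rho> f \<cdot> f = 0\<close>.\<close>
    using proj_orthogonal(1)[of k "Dom X f" "Cod X f" "Cod X f"] f by simp
next
  fix f' g' f g assume perp: "decision_disjoint X f' g'" and le: "f \<sqsubseteq> f'" "g \<sqsubseteq> g'"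
  let ?A = "Dom X f"
  have [simp]: "f \<in> Arr X" "g \<in> Arr X" "f' \<in> Arr X" "g' \<in> Arr X"
    "Dom X f' = ?A" "Dom X g = ?A" "Dom X g' = ?A"
    using perp le by (auto simp: rle_def decision_disjoint_def)
  obtain d where d: "d \<in> hom X ?A (?A \<oplus> ?A)"
    "d \<cdot> proj0 ?A ?A = \<rho> f'" "d \<cdot> proj1 ?A ?A = \<rho> g'"
    using perp by (auto simp: decision_disjoint_iff_Rst[of f' ?A g'])
  then have [simp]: "d \<in> Arr X" "Dom X d = ?A" "Cod X d = ?A \<oplus> ?A"
    by (auto simp: hom_iff)
  \<comment> \<open>The decision for the larger pair serves the smaller one too: its
    quasi-projections \<open>\<rho> f'\<close> and \<open>\<rho> g'\<close> act as identities on
    \<open>f\<close> and \<open>g\<close>.\<close>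
  let ?k = "d \<cdot> copair (f \<cdot> inj0 (Cod X f) (Cod X g)) (g \<cdot> inj1 (Cod X f) (Cod X g))"
  have "?k \<cdot> proj0 (Cod X f) (Cod X g) = f" "?k \<cdot> proj1 (Cod X f) (Cod X g) = g"
    using Comp_eq_extend[OF d(2), of f] Comp_eq_extend[OF d(3), of g]
    by (simp_all add: copair_inj_proj rle_Rst_absorb le)
  then show "decision_disjoint X f g"
    by (intro decision_disjoint_iff[THEN iffD2, of f ?A "Cod X f" g "Cod X g"] bexI[of _ ?k])
      (auto simp: hom_iff)
next
  fix f g A B C h A' k B' k' C'
  assume perp: "decision_disjoint X f g"
    and f: "f \<in> hom X A B" and g: "g \<in> hom X A C" and "h \<in> hom X A' A"
    "k \<in> hom X B B'" "k' \<in> hom X C C'"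
  then have [simp]: "f \<in> Arr X" "Dom X f = A" "Cod X f = B" "g \<in> Arr X" "Dom X g = A" "Cod X g = C"
    "h \<in> Arr X" "Dom X h = A'" "Cod X h = A" "k \<in> Arr X" "Dom X k = B" "Cod X k = B'"
    "k' \<in> Arr X" "Dom X k' = C" "Cod X k' = C'"
    by (auto simp: hom_iff)
  have [simp]: "A \<in> Obj X" "B \<in> Obj X" "C \<in> Obj X" "B' \<in> Obj X" "C' \<in> Obj X"
    using Dom_Cod_Obj[of f] Dom_Cod_Obj[of g] Dom_Cod_Obj[of k] Dom_Cod_Obj[of k'] by auto
  obtain p where p: "p \<in> hom X A (B \<oplus> C)" "p \<cdot> proj0 B C = f" "p \<cdot> proj1 B C = g"
    using perp decision_disjoint_iff[OF f g] by auto
  then have [simp]: "p \<in> Arr X" "Dom X p = A" "Cod X p = B \<oplus> C"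
    by (auto simp: hom_iff)
  \<comment> \<open>The witness \<open>p\<close> is precomposed with \<open>h\<close> and
    postcomposed with \<open>k + k'\<close>.\<close>
  let ?q = "h \<cdot> (p \<cdot> copair (k \<cdot> inj0 B' C') (k' \<cdot> inj1 B' C'))"
  have "?q \<cdot> proj0 B' C' = h \<cdot> f \<cdot> k" "?q \<cdot> proj1 B' C' = h \<cdot> g \<cdot> k'"
    using Comp_eq_extend[OF p(2), of k] Comp_eq_extend[OF p(3), of k']
    by (simp_all add: copair_inj_proj)
  then show "decision_disjoint X (h \<cdot> f \<cdot> k) (h \<cdot> g \<cdot> k')"
    by (intro decision_disjoint_iff[THEN iffD2, of _ A' B' _ C'] bexI[of _ ?q])
      (auto simp: hom_iff)
next
  fix f g assume perp: "decision_disjoint X f g"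
  then have "f \<in> Arr X" "g \<in> Arr X" "Dom X g = Dom X f"
    by (auto simp: decision_disjoint_def)
  with perp show "decision_disjoint X (\<rho> f) (\<rho> g)"
    by (simp add: decision_disjoint_iff_Rst[of _ "Dom X f"])
qed

lemma decision_disjoint_joins: "has_binary_perp_joins X (decision_disjoint X)"
  unfolding has_binary_perp_joins_def
proof (intro allI impI, elim conjE)
  fix A B f g
  assume f: "f \<in> hom X A B" and g: "g \<in> hom X A B" and perp: "decision_disjoint X f g"
  have [simp]: "B \<in> Obj X"
    using f by (auto simp: hom_iff)
  obtain k where k: "k \<in> hom X A (B \<oplus> B)" "k \<cdot> proj0 B B = f" "k \<cdot> proj1 B B = g"
    using perp decision_disjoint_iff[OF f g] by auto
  \<comment> \<open>Stability under precomposition: \<open>h \<cdot> k\<close> has quasi-projections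
    \<open>h \<cdot> f\<close> and \<open>h \<cdot> g\<close>, so the same construction applies to
    it.\<close>
  have "is_join X (h \<cdot> f) (h \<cdot> g) (h \<cdot> (k \<cdot> fold2 B))" if h: "h \<in> hom X A' A" for A' h
    using proj_fold_is_join[of "h \<cdot> k" A' B] h k by (auto simp: hom_iff)
  moreover have "is_join X f g (k \<cdot> fold2 B)"
    using proj_fold_is_join[OF k(1)] k by simp
  ultimately show "\<exists>j. is_join X f g j \<and>
      (\<forall>A' h. h \<in> hom X A' A \<longrightarrow> is_join X (h \<cdot> f) (h \<cdot> g) (h \<cdot> j))"
    by blast
qed

end

theorem theorem7p10:
  fixes X :: "('o, 'm, 'x) ccat_scheme"
  assumes "extensive_restriction_category X"
  shows "interference_relation X (decision_disjoint X)
    \<and> perp_restriction_category X (decision_disjoint X)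
    \<and> has_binary_perp_joins X (decision_disjoint X)"
proof -
  interpret extensive_restriction_category X
    by fact
  have "interference_relation X (decision_disjoint X)"
    by (rule decision_disjoint_interference)
  then show ?thesis
    by (intro conjI perp_restriction_category.intro decision_disjoint_joins
        restriction_category_with_zeroes_axioms)
qed

end
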